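(* In the model $\dot{x}=-\sigma x+f(t)$ with $\sigma\ge 0$ and measurable $f\in L^{\infty}_{\mathrm{loc}}(\mathbb{R})$, the mapping $f\mapsto\Phi$, which assigns to the input $f$ the firing map $\Phi=\Phi_f$ of the model, is continuous from the $L^{\infty}_{\mathrm{loc}}(\mathbb{R})$-topology into the $C^0(\mathbb{R})$-topology at every point $f$ satisfying $f(t)-\sigma>\varsigma$ for a.e. $t\in\mathbb{R}$ for some $\varsigma>0$.
   Context: Firing map: for $\sigma\ge 0$ and $f\in L^1_{\mathrm{loc}}(\mathbb{R})$, the firing map of $\dot{x}=-\sigma x+f(t)$ (with reset value $0$ and threshold $1$) is $\Phi_f(t):=\inf\{t_*>t:\ e^{\sigma t}\le\int_t^{t_*}[f(u)-\sigma]e^{\sigma u}\,du\}$. $L^{\infty}_{\mathrm{loc}}(\mathbb{R})$ is the space of functions $f:\mathbb{R}\to\mathbb{R}$ with $\operatorname{ess\,sup}_K|f|<\infty$ for every compact $K\subset\mathbb{R}$, with seminorms $\|f\|_{L^\infty([-k,k])}:=\operatorname{ess\,sup}_{[-k,k]}|f|$, $k=1,2,\dots$, and metric $d_{L^\infty_{\mathrm{loc}}}(f,g)=\sum_{k\ge1}2^{-k}\frac{\|f-g\|_{L^\infty([-k,k])}}{1+\|f-g\|_{L^\infty([-k,k])}}$. $C^0(\mathbb{R})$ is the space of continuous functions $\mathbb{R}\to\mathbb{R}$ with the metric defined by the same formula using the seminorms $\sup_{t\in[-k,k]}|f(t)|$. *)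

theory Defs
  imports "HOL-Analysis.Analysis" "HOL-Probability.Essential_Supremum"
begin

text \<open>The infimum is taken in the extended reals, so the value is \<open>\<infinity>\<close> if the neuron
  never fires after time \<open>t\<close>.\<close>

definition firing_map :: "real \<Rightarrow> (real \<Rightarrow> real) \<Rightarrow> real \<Rightarrow> ereal" where
  "firing_map \<sigma> f t =
     Inf (ereal ` {s. t < s \<and>
       exp (\<sigma> * t) \<le> (LINT u:{t..s}|lebesgue. (f u - \<sigma>) * exp (\<sigma> * u))})"

definition Linf_loc :: "(real \<Rightarrow> real) set" where
  "Linf_loc = {f \<in> borel_measurable lebesgue.
     \<forall>K. compact K \<longrightarrow> esssup (lebesgue_on K) (\<lambda>t. ereal \<bar>f t\<bar>) < \<infinity>}"

text \<open>The map \<open>s \<mapsto> s / (1 + s)\<close>, with the limiting value \<open>1\<close> at \<open>s = \<infinity>\<close>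
  (ereal division would give \<open>\<infinity> / \<infinity> = 0\<close>).\<close>

definition bounded_seminorm :: "ereal \<Rightarrow> real" where
  "bounded_seminorm s = (if s = \<infinity> then 1 else real_of_ereal s / (1 + real_of_ereal s))"

text \<open>In both metrics the sum runs over \<open>k \<ge> 1\<close>, written as \<open>Suc k\<close>. On functions (rather than
  classes modulo a.e. equality) the first one is only a pseudometric.\<close>

definition Linf_loc_dist :: "(real \<Rightarrow> real) \<Rightarrow> (real \<Rightarrow> real) \<Rightarrow> real" where
  "Linf_loc_dist f g =
     (\<Sum>k. (1 / 2) ^ Suc k * bounded_seminorm
        (esssup (lebesgue_on {- real (Suc k)..real (Suc k)}) (\<lambda>t. ereal \<bar>f t - g t\<bar>)))"

text \<open>Firing maps are extended-real valued, so the space of continuous functions from the reals to the reals is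
  represented by its image under the embedding of the reals into the extended reals. The metric is
  written for arbitrary extended-real valued functions: an input \<open>g\<close> that is close to \<open>f\<close> may
  behave arbitrarily far out, where its firing map can be infinite or discontinuous. If
  one function is finite and the other is infinite somewhere on \<open>[-k, k]\<close>, the \<open>k\<close>-th
  seminorm is \<open>\<infinity>\<close> and contributes the maximal amount \<open>2\<^sup>-\<^sup>k\<close>.\<close>

definition C0 :: "(real \<Rightarrow> ereal) set" where
  "C0 = {\<phi>. \<exists>h :: real \<Rightarrow> real. continuous_on UNIV h \<and> \<phi> = (\<lambda>t. ereal (h t))}"

definition C0_dist :: "(real \<Rightarrow> ereal) \<Rightarrow> (real \<Rightarrow> ereal) \<Rightarrow> real" where
  "C0_dist \<phi> \<psi> =
     (\<Sum>k. (1 / 2) ^ Suc k * bounded_seminorm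
        (SUP t\<in>{- real (Suc k)..real (Suc k)}. \<bar>\<phi> t - \<psi> t\<bar>))"

end

theory Submission
  imports Defs
begin

text \<open>Let \<open>F f t s\<close> be the integral in the definition of the firing map. If \<open>f - \<sigma> \<ge> m > 0\<close> almost
  everywhere, then \<open>F f t\<close> increases at least at rate \<open>m exp (\<sigma> t)\<close>, so it attains \<open>exp (\<sigma> t)\<close>
  exactly once, at a time in \<open>(t, t + 1/m]\<close>, and a perturbation of \<open>F f t\<close> or of the level moves
  this time by at most the size of the perturbation divided by the rate. This gives both the
  continuity of the firing map of \<open>f\<close> and its proximity to the firing map of \<open>g\<close>, since closeness of
  \<open>g\<close> to \<open>f\<close> on a long interval gives \<open>g - \<sigma> \<ge> m/2\<close> there.\<close>

subsection \<open>The integrated input\<close>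

text \<open>The gauge integral replaces the Lebesgue set integral of the firing condition, because
  splitting at an intermediate point and continuity in the upper limit are then standard facts. The
  two agree for inputs in \<open>Linf_loc\<close>.\<close>

definition charge :: "real \<Rightarrow> (real \<Rightarrow> real) \<Rightarrow> real \<Rightarrow> real \<Rightarrow> real" where
  "charge \<sigma> f t s = integral {t..s} (\<lambda>u. (f u - \<sigma>) * exp (\<sigma> * u))"

lemma Linf_loc_measurable: "f \<in> Linf_loc \<Longrightarrow> f \<in> borel_measurable lebesgue"
  by (simp add: Linf_loc_def)

lemma Linf_loc_bound:
  assumes "f \<in> Linf_loc"
  obtains B where "B \<ge> 0" "AE u in lebesgue_on {a..b}. \<bar>f u\<bar> \<le> B"
proof -
  let ?S = "esssup (lebesgue_on {a..b}) (\<lambda>t. ereal \<bar>f t\<bar>)"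
  have "?S < \<infinity>" using assms by (simp add: Linf_loc_def)
  then obtain B where B: "?S \<le> ereal B"
    using less_PInf_Ex_of_nat[of ?S] by (auto intro: less_imp_le)
  \<comment> \<open>The maximum with 0 secures a nonnegative bound even on an empty interval, where
    the essential supremum is negative.\<close>
  have "AE u in lebesgue_on {a..b}. \<bar>f u\<bar> \<le> max B 0"
    using esssup_AE[of "\<lambda>t. ereal \<bar>f t\<bar>" "lebesgue_on {a..b}"]
  proof eventually_elim
    case (elim u)
    then have "ereal \<bar>f u\<bar> \<le> ereal B" using B by (rule order_trans)
    then show ?case by simp
  qed
  then show thesis using that[of "max B 0"] by simp
qed

text \<open>Since \<open>\<sigma> \<ge> 0\<close>, the exponential is at most
  \<open>exp (\<sigma> * b)\<close> on the interval, so the integrand is essentially bounded on a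
  space of finite measure.\<close>

lemma set_integrable_charge:
  assumes "0 \<le> \<sigma>" "f \<in> Linf_loc"
  shows "set_integrable lebesgue {a..b} (\<lambda>u. (f u - \<sigma>) * exp (\<sigma> * u))"
proof -
  obtain B where B: "B \<ge> 0" "AE u in lebesgue_on {a..b}. \<bar>f u\<bar> \<le> B"
    using Linf_loc_bound[OF assms(2)] by metis
  have [measurable]: "f \<in> borel_measurable lebesgue"
    using assms(2) by (rule Linf_loc_measurable)
  have exp_meas: "(\<lambda>u. exp (\<sigma> * u)) \<in> borel_measurable lebesgue"
    by (intro measurable_completion) (auto intro!: borel_measurable_continuous_onI continuous_intros)
  interpret finite_measure "lebesgue_on {a..b}"
    by (rule finite_measure_lebesgue_on) simp
  have "AE u in lebesgue_on {a..b}. u \<in> {a..b}"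
    using AE_space[of "lebesgue_on {a..b}"] by simp
  with B(2) have "AE u in lebesgue_on {a..b}.
      norm ((f u - \<sigma>) * exp (\<sigma> * u)) \<le> (B + \<sigma>) * exp (\<sigma> * b)"
  proof eventually_elim
    case (elim u)
    then have "exp (\<sigma> * u) \<le> exp (\<sigma> * b)" using assms(1) by (simp add: mult_left_mono)
    moreover have "\<bar>f u - \<sigma>\<bar> \<le> B + \<sigma>" using elim assms(1) by linarith
    ultimately show ?case by (simp add: abs_mult mult_mono)
  qed
  moreover have "(\<lambda>u. (f u - \<sigma>) * exp (\<sigma> * u)) \<in> borel_measurable (lebesgue_on {a..b})"
    by (intro measurable_restrict_space1 borel_measurable_times exp_meas) measurable
  ultimately have "integrable (lebesgue_on {a..b}) (\<lambda>u. (f u - \<sigma>) * exp (\<sigma> * u))"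
    by (rule integrable_const_bound)
  then show ?thesis
    unfolding set_integrable_def by (subst (asm) integrable_restrict_space) auto
qed

lemma set_integral_charge:
  assumes "0 \<le> \<sigma>" "f \<in> Linf_loc"
  shows "(LINT u:{t..s}|lebesgue. (f u - \<sigma>) * exp (\<sigma> * u)) = charge \<sigma> f t s"
  unfolding charge_def
  by (rule set_lebesgue_integral_eq_integral(2)[OF set_integrable_charge[OF assms]])

lemma charge_combine:
  assumes "0 \<le> \<sigma>" "f \<in> Linf_loc" "a \<le> b" "b \<le> c"
  shows "charge \<sigma> f a b + charge \<sigma> f b c = charge \<sigma> f a c"
  unfolding charge_def
  by (rule Henstock_Kurzweil_Integration.integral_combine[OF assms(3,4)])
     (rule set_lebesgue_integral_eq_integral(1)[OF set_integrable_charge[OF assms(1,2)]])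

lemma continuous_on_charge:
  assumes "0 \<le> \<sigma>" "f \<in> Linf_loc"
  shows "continuous_on {a..b} (charge \<sigma> f a)"
  unfolding charge_def
  by (rule indefinite_integral_continuous_1)
     (rule set_lebesgue_integral_eq_integral(1)[OF set_integrable_charge[OF assms]])

text \<open>The exponential is nondecreasing, so its smallest value on the interval is
  \<open>exp (\<sigma> * a)\<close>, and the integrand stays above a constant.\<close>

lemma charge_lower_bound:
  assumes "0 \<le> \<sigma>" "f \<in> Linf_loc" "a \<le> b" "0 \<le> m"
    and AE: "AE u in lebesgue. u \<in> {a..b} \<longrightarrow> m \<le> f u - \<sigma>"
  shows "m * exp (\<sigma> * a) * (b - a) \<le> charge \<sigma> f a b"
proof -
  have "(LINT u:{a..b}|lebesgue. m * exp (\<sigma> * a)) \<le> (LINT u:{a..b}|lebesgue. (f u - \<sigma>) * exp (\<sigma> * u))"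
  proof (rule set_integral_mono_AE[OF _ set_integrable_charge[OF assms(1,2)]])
    show "set_integrable lebesgue {a..b} (\<lambda>u. m * exp (\<sigma> * a))"
      unfolding set_integrable_def by (intro integrable_scaleR_left integrable_real_indicator) (auto simp: emeasure_lborel_Icc_eq)
    show "AE u\<in>{a..b} in lebesgue. m * exp (\<sigma> * a) \<le> (f u - \<sigma>) * exp (\<sigma> * u)"
      using AE
    proof eventually_elim
      case (elim u)
      show ?case
      proof
        assume u: "u \<in> {a..b}"
        then have "exp (\<sigma> * a) \<le> exp (\<sigma> * u)" using assms(1) by (simp add: mult_left_mono)
        with elim u assms(4) show "m * exp (\<sigma> * a) \<le> (f u - \<sigma>) * exp (\<sigma> * u)"
          by (intro mult_mono) auto
      qed
    qed
  qed
  moreover have "(LINT u:{a..b}|lebesgue. m * exp (\<sigma> * a)) = m * exp (\<sigma> * a) * (b - a)"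
    using assms(3) by (simp add: set_lebesgue_integral_def)
  ultimately show ?thesis by (simp only: set_integral_charge[OF assms(1,2)])
qed

text \<open>The terms with \<open>\<sigma>\<close> cancel in the difference of the integrands,
  leaving \<open>(f u - g u) * exp (\<sigma> * u)\<close>, whose exponential factor is largest at
  \<open>b\<close>.\<close>

lemma charge_perturbation:
  assumes "0 \<le> \<sigma>" "f \<in> Linf_loc" "g \<in> Linf_loc" "a \<le> b" "0 \<le> \<eta>"
    and AE: "AE u in lebesgue. u \<in> {a..b} \<longrightarrow> \<bar>f u - g u\<bar> \<le> \<eta>"
  shows "\<bar>charge \<sigma> f a b - charge \<sigma> g a b\<bar> \<le> \<eta> * exp (\<sigma> * b) * (b - a)"
proof -
  let ?w = "\<lambda>f u. (f u - \<sigma>) * exp (\<sigma> * u)" and ?c = "\<eta> * exp (\<sigma> * b)"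
  have int: "set_integrable lebesgue {a..b} (?w h)" if "h \<in> Linf_loc" for h
    by (rule set_integrable_charge[OF assms(1) that])
  have const: "set_integrable lebesgue {a..b} (\<lambda>u. ?c)"
    unfolding set_integrable_def by (intro integrable_scaleR_left integrable_real_indicator) (auto simp: emeasure_lborel_Icc_eq)
  have const_eq: "(LINT u:{a..b}|lebesgue. ?c) = ?c * (b - a)"
    using assms(4) by (simp add: set_lebesgue_integral_def)
  \<comment> \<open>Stated for an arbitrary pair, so that exchanging \<open>f\<close> and
    \<open>g\<close> yields the absolute value.\<close>
  have one_sided: "charge \<sigma> h a b - charge \<sigma> k a b \<le> ?c * (b - a)"
    if h: "h \<in> Linf_loc" and k: "k \<in> Linf_loc"
      and hk: "AE u in lebesgue. u \<in> {a..b} \<longrightarrow> \<bar>h u - k u\<bar> \<le> \<eta>" for h k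
  proof -
    have "AE u\<in>{a..b} in lebesgue. ?w h u - ?w k u \<le> ?c"
      using hk
    proof eventually_elim
      case (elim u)
      show ?case
      proof
        assume u: "u \<in> {a..b}"
        then have "exp (\<sigma> * u) \<le> exp (\<sigma> * b)" using assms(1) by (simp add: mult_left_mono)
        then have "\<bar>h u - k u\<bar> * exp (\<sigma> * u) \<le> ?c"
          using elim u assms(5) by (intro mult_mono) auto
        moreover have "(h u - k u) * exp (\<sigma> * u) \<le> \<bar>h u - k u\<bar> * exp (\<sigma> * u)"
          by (intro mult_right_mono) auto
        ultimately show "?w h u - ?w k u \<le> ?c" by (simp add: left_diff_distrib)
      qed
    qed
    then have "(LINT u:{a..b}|lebesgue. ?w h u - ?w k u) \<le> (LINT u:{a..b}|lebesgue. ?c)"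
      by (intro set_integral_mono_AE set_integral_diff(1) int h k const)
    then show ?thesis
      unfolding set_integral_diff(2)[OF int[OF h] int[OF k]] const_eq
      by (simp add: set_integral_charge[OF assms(1)] h k)
  qed
  have "AE u in lebesgue. u \<in> {a..b} \<longrightarrow> \<bar>g u - f u\<bar> \<le> \<eta>"
    using AE by (simp add: abs_minus_commute)
  from one_sided[OF assms(3,2) this] one_sided[OF assms(2,3) AE] show ?thesis by linarith
qed

text \<open>A quantitative form of injectivity: it converts closeness of charges into closeness of
  times. The rate on \<open>{x..y}\<close> is weakened from \<open>exp (\<sigma> * x)\<close> to
  \<open>exp (\<sigma> * c)\<close> to get one constant for all pairs in
  \<open>{c..d}\<close>.\<close>

lemma charge_gap:
  assumes "0 \<le> \<sigma>" "f \<in> Linf_loc" "0 \<le> m" "c \<le> x" "c \<le> y" "x \<le> d" "y \<le> d"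
    and AE: "AE u in lebesgue. u \<in> {c..d} \<longrightarrow> m \<le> f u - \<sigma>"
  shows "m * exp (\<sigma> * c) * \<bar>x - y\<bar> \<le> \<bar>charge \<sigma> f c x - charge \<sigma> f c y\<bar>"
proof -
  have ordered: "m * exp (\<sigma> * c) * (y - x) \<le> charge \<sigma> f c y - charge \<sigma> f c x"
    if "c \<le> x" "x \<le> y" "y \<le> d" for x y
  proof -
    have "AE u in lebesgue. u \<in> {x..y} \<longrightarrow> m \<le> f u - \<sigma>"
      using AE by eventually_elim (use that in auto)
    then have "m * exp (\<sigma> * x) * (y - x) \<le> charge \<sigma> f x y"
      using charge_lower_bound assms that by blast
    moreover have "m * exp (\<sigma> * c) * (y - x) \<le> m * exp (\<sigma> * x) * (y - x)"
      using assms(1,3) that by (intro mult_right_mono mult_left_mono) (auto simp: mult_left_mono)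
    ultimately show ?thesis using charge_combine[OF assms(1,2) that(1,2)] by linarith
  qed
  show ?thesis
    using ordered[of x y] ordered[of y x] assms(4-7) by (cases "x \<le> y") (auto simp: abs_if)
qed

subsection \<open>The firing time\<close>

text \<open>By time \<open>t + 1 / m\<close> the charge has reached at least
  \<open>m * exp (\<sigma> * t) * (1 / m)\<close>, which is the level, so the intermediate value
  theorem gives a crossing; strict growth makes it the first one. The rate is assumed on this window
  only, so that inputs uncontrolled far out are covered.\<close>

lemma firing_map_eq:
  assumes "0 \<le> \<sigma>" "f \<in> Linf_loc" "0 < m"
    and AE: "AE u in lebesgue. u \<in> {t..t + 1 / m} \<longrightarrow> m \<le> f u - \<sigma>"
  obtains s where "firing_map \<sigma> f t = ereal s" "t < s" "s \<le> t + 1 / m"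
    "charge \<sigma> f t s = exp (\<sigma> * t)"
proof -
  let ?T = "t + 1 / m"
  have tT: "t \<le> ?T" using assms(3) by simp
  have "m * exp (\<sigma> * t) * (?T - t) \<le> charge \<sigma> f t ?T"
    using charge_lower_bound[OF assms(1,2) tT _ AE] assms(3) by simp
  then have top: "exp (\<sigma> * t) \<le> charge \<sigma> f t ?T" using assms(3) by simp
  have bot: "charge \<sigma> f t t = 0" by (simp add: charge_def)
  obtain s where s: "t \<le> s" "s \<le> ?T" "charge \<sigma> f t s = exp (\<sigma> * t)"
    using IVT'[of "charge \<sigma> f t" t "exp (\<sigma> * t)" ?T] top bot tT continuous_on_charge[OF assms(1,2)]
    by auto
  have "s \<noteq> t" using s(3) bot by auto
  with s have "t < s" by simp
  have "Inf (ereal ` {s. t < s \<and> exp (\<sigma> * t) \<le> charge \<sigma> f t s}) = ereal s"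
  proof (rule Inf_eqI)
    fix z assume "z \<in> ereal ` {s. t < s \<and> exp (\<sigma> * t) \<le> charge \<sigma> f t s}"
    then obtain r where r: "z = ereal r" "t < r" "exp (\<sigma> * t) \<le> charge \<sigma> f t r" by auto
    \<comment> \<open>If \<open>r\<close> came before \<open>s\<close>, the positive charge
      collected between them would push the charge at \<open>s\<close> above the level it
      equals.\<close>
    have "s \<le> r"
    proof (rule ccontr)
      assume "\<not> s \<le> r"
      then have rs: "r < s" by simp
      have "AE u in lebesgue. u \<in> {r..s} \<longrightarrow> m \<le> f u - \<sigma>"
        using AE by eventually_elim (use r s in auto)
      then have "m * exp (\<sigma> * r) * (s - r) \<le> charge \<sigma> f r s"
        using charge_lower_bound[OF assms(1,2), of r s m] rs assms(3) by simp
      moreover have "0 < m * exp (\<sigma> * r) * (s - r)" using rs assms(3) by simp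
      moreover have "charge \<sigma> f t r + charge \<sigma> f r s = charge \<sigma> f t s"
        using charge_combine[OF assms(1,2)] r rs by simp
      ultimately show False using r s by linarith
    qed
    then show "ereal s \<le> z" using r by simp
  next
    fix y assume "\<And>z. z \<in> ereal ` {s. t < s \<and> exp (\<sigma> * t) \<le> charge \<sigma> f t s} \<Longrightarrow> y \<le> z"
    then show "y \<le> ereal s" using \<open>t < s\<close> s by auto
  qed
  then have "firing_map \<sigma> f t = ereal s"
    by (simp add: firing_map_def set_integral_charge[OF assms(1,2)])
  then show thesis using that \<open>t < s\<close> s by blast
qed

text \<open>With a fixed base point the firing time \<open>h t\<close> solves
  \<open>W (h t) = W t + exp (\<sigma> * t)\<close>. The right side is continuous in
  \<open>t\<close>, and \<open>W\<close> stretches distances by at least a factor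
  \<open>K > 0\<close>, so \<open>h\<close> is continuous.\<close>

lemma firing_map_in_C0:
  assumes "0 \<le> \<sigma>" "f \<in> Linf_loc" "0 < m" and AE: "AE u in lebesgue. m \<le> f u - \<sigma>"
  shows "firing_map \<sigma> f \<in> C0"
proof -
  have "\<exists>s. firing_map \<sigma> f t = ereal s \<and> t < s \<and> s \<le> t + 1 / m \<and> charge \<sigma> f t s = exp (\<sigma> * t)" for t
  proof -
    have "AE u in lebesgue. u \<in> {t..t + 1 / m} \<longrightarrow> m \<le> f u - \<sigma>" using AE by eventually_elim auto
    from firing_map_eq[OF assms(1-3) this] show ?thesis by metis
  qed
  then obtain h where h: "\<And>t. firing_map \<sigma> f t = ereal (h t)" "\<And>t. t < h t"
      "\<And>t. h t \<le> t + 1 / m" "\<And>t. charge \<sigma> f t (h t) = exp (\<sigma> * t)"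
    by metis
  have "isCont h x" for x
  proof -
    \<comment> \<open>The interval \<open>{c..d}\<close> contains both \<open>t\<close> and
      \<open>h t\<close> for every \<open>t\<close> within distance 1 of \<open>x\<close>, since
      firing takes at most \<open>1 / m\<close>.\<close>
    define c where "c = x - 1"
    define d where "d = x + 1 + 1 / m"
    define W where "W = charge \<sigma> f c"
    define K where "K = m * exp (\<sigma> * c)"
    have K: "K > 0" using assms(3) by (simp add: K_def)
    have WC: "continuous_on {c..d} W"
      unfolding W_def by (rule continuous_on_charge[OF assms(1,2)])
    have "0 < 1 / m" using assms(3) by simp
    have xcd: "x \<in> {c<..<d}" using \<open>0 < 1 / m\<close> unfolding c_def d_def greaterThanLessThan_iff by linarith
    then have "isCont W x"
      using continuous_on_interior[OF WC] by simp
    then have "((\<lambda>t. \<bar>(W t + exp (\<sigma> * t)) - (W x + exp (\<sigma> * x))\<bar> / K) \<longlongrightarrow>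
        \<bar>(W x + exp (\<sigma> * x)) - (W x + exp (\<sigma> * x))\<bar> / K) (at x)"
      using K by (intro tendsto_intros) (auto simp: isCont_def)
    then have lim: "((\<lambda>t. \<bar>(W t + exp (\<sigma> * t)) - (W x + exp (\<sigma> * x))\<bar> / K) \<longlongrightarrow> 0) (at x)"
      by simp
    have "AE u in lebesgue. u \<in> {c..d} \<longrightarrow> m \<le> f u - \<sigma>" using AE by eventually_elim auto
    note gap = charge_gap[OF assms(1,2) _ _ _ _ _ this]
    have Wh: "W (h t) = W t + exp (\<sigma> * t)" if "c \<le> t" for t
      using charge_combine[OF assms(1,2) that, of "h t"] h(2,4)[of t] by (simp add: W_def)
    have bound: "\<bar>h t - h x\<bar> \<le> \<bar>(W t + exp (\<sigma> * t)) - (W x + exp (\<sigma> * x))\<bar> / K"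
      if "dist t x < 1" for t
    proof -
      have t: "c \<le> t" "t \<le> x + 1" using that by (auto simp: dist_real_def c_def)
      have "K * \<bar>h t - h x\<bar> \<le> \<bar>W (h t) - W (h x)\<bar>"
        unfolding K_def W_def
        by (rule gap) (use h(2,3)[of t] h(2,3)[of x] t xcd assms(3) in \<open>auto simp: d_def\<close>)
      also have "\<dots> = \<bar>(W t + exp (\<sigma> * t)) - (W x + exp (\<sigma> * x))\<bar>"
        using t xcd by (simp add: Wh)
      finally show ?thesis using K by (simp add: field_simps)
    qed
    have "\<forall>\<^sub>F t in at x. norm (h t - h x) \<le> \<bar>(W t + exp (\<sigma> * t)) - (W x + exp (\<sigma> * x))\<bar> / K"
      unfolding eventually_at by (rule exI[of _ 1]) (use bound in auto)
    from Lim_null_comparison[OF this lim] have "((\<lambda>t. h t - h x) \<longlongrightarrow> 0) (at x)" .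
    then show ?thesis by (simp add: isCont_def LIM_zero_iff)
  qed
  then have "continuous_on UNIV h" by (simp add: continuous_at_imp_continuous_on)
  moreover have "firing_map \<sigma> f = (\<lambda>t. ereal (h t))" using h(1) by auto
  ultimately show ?thesis unfolding C0_def by blast
qed

text \<open>Both inputs reach the same level, so the charge of \<open>f\<close> between the two
  firing times equals the discrepancy of the two charges at the firing time of \<open>g\<close>.
  Dividing its bound \<open>\<eta> * exp (\<sigma> * (t + 1 / m)) / m\<close> by the rate
  \<open>m * exp (\<sigma> * t)\<close> gives an estimate uniform in \<open>t\<close>.\<close>

lemma firing_map_perturbation:
  assumes "0 \<le> \<sigma>" "f \<in> Linf_loc" "g \<in> Linf_loc" "0 < m" "0 \<le> \<eta>"
    and f: "AE u in lebesgue. u \<in> {t..t + 1 / m} \<longrightarrow> m \<le> f u - \<sigma>"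
    and g: "AE u in lebesgue. u \<in> {t..t + 1 / m} \<longrightarrow> m \<le> g u - \<sigma>"
    and fg: "AE u in lebesgue. u \<in> {t..t + 1 / m} \<longrightarrow> \<bar>f u - g u\<bar> \<le> \<eta>"
  shows "\<bar>firing_map \<sigma> f t - firing_map \<sigma> g t\<bar> \<le> ereal (\<eta> * exp (\<sigma> / m) / m\<^sup>2)"
proof -
  obtain s where s: "firing_map \<sigma> f t = ereal s" "t < s" "s \<le> t + 1 / m"
      "charge \<sigma> f t s = exp (\<sigma> * t)"
    using firing_map_eq[OF assms(1,2,4) f] by metis
  obtain r where r: "firing_map \<sigma> g t = ereal r" "t < r" "r \<le> t + 1 / m"
      "charge \<sigma> g t r = exp (\<sigma> * t)"
    using firing_map_eq[OF assms(1,3,4) g] by metis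
  have "AE u in lebesgue. u \<in> {t..r} \<longrightarrow> \<bar>f u - g u\<bar> \<le> \<eta>"
    using fg by eventually_elim (use r in auto)
  then have "\<bar>charge \<sigma> f t r - charge \<sigma> g t r\<bar> \<le> \<eta> * exp (\<sigma> * r) * (r - t)"
    using charge_perturbation[OF assms(1-3), of t r \<eta>] r assms(5) by simp
  also have "\<dots> \<le> \<eta> * exp (\<sigma> * (t + 1 / m)) * (1 / m)"
  proof -
    have "\<sigma> * r \<le> \<sigma> * (t + 1 / m)" using r assms(1) by (intro mult_left_mono)
    then show ?thesis using r assms(4,5) by (intro mult_mono mult_left_mono) auto
  qed
  \<comment> \<open>Here \<open>charge \<sigma> g t r\<close> is replaced by
    \<open>charge \<sigma> f t s\<close>: both equal \<open>exp (\<sigma> * t)\<close>.\<close>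
  finally have "\<bar>charge \<sigma> f t s - charge \<sigma> f t r\<bar> \<le> \<eta> * exp (\<sigma> * (t + 1 / m)) * (1 / m)"
    using s r by simp
  moreover have "m * exp (\<sigma> * t) * \<bar>s - r\<bar> \<le> \<bar>charge \<sigma> f t s - charge \<sigma> f t r\<bar>"
    by (rule charge_gap[OF assms(1,2) _ _ _ _ _ f]) (use s r assms(4) in auto)
  ultimately have "m * exp (\<sigma> * t) * \<bar>s - r\<bar> \<le> \<eta> * exp (\<sigma> * (t + 1 / m)) * (1 / m)" by linarith
  also have "\<dots> = m * exp (\<sigma> * t) * (\<eta> * exp (\<sigma> / m) / m\<^sup>2)"
    using assms(4) by (simp add: distrib_left exp_add power2_eq_square)
  finally have "\<bar>s - r\<bar> \<le> \<eta> * exp (\<sigma> / m) / m\<^sup>2"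
    using assms(4) by (simp add: mult_le_cancel_left_pos del: times_divide_eq_right)
  then show ?thesis using s r by simp
qed

subsection \<open>The metrics\<close>

lemma bounded_seminorm_nonneg: "0 \<le> s \<Longrightarrow> 0 \<le> bounded_seminorm s"
  by (cases s) (auto simp: bounded_seminorm_def)

lemma bounded_seminorm_le_1: "0 \<le> s \<Longrightarrow> bounded_seminorm s \<le> 1"
  by (cases s) (auto simp: bounded_seminorm_def)

lemma bounded_seminorm_le:
  assumes "0 \<le> s" "s \<le> ereal \<delta>"
  shows "bounded_seminorm s \<le> \<delta>"
proof -
  obtain x where x: "s = ereal x" "0 \<le> x" "x \<le> \<delta>" using assms by (cases s) auto
  have "x / (1 + x) \<le> x / 1" using x by (intro divide_left_mono) auto
  then show ?thesis using x by (simp add: bounded_seminorm_def)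
qed

text \<open>The map \<open>s / (1 + s)\<close> is strictly increasing on finite values, and its
  value 1 at infinity exceeds \<open>\<eta> / (1 + \<eta>)\<close>, which rules out an infinite
  seminorm.\<close>

lemma less_if_bounded_seminorm_less:
  assumes "0 \<le> s" "0 < \<eta>" "bounded_seminorm s < \<eta> / (1 + \<eta>)"
  shows "s < ereal \<eta>"
proof (cases s)
  case (real x)
  with assms have "x / (1 + x) < \<eta> / (1 + \<eta>)" "0 \<le> x" by (auto simp: bounded_seminorm_def)
  with assms(2) have "x < \<eta>" by (simp add: field_simps)
  with real show ?thesis by simp
next
  case PInf
  with assms show ?thesis by (simp add: bounded_seminorm_def field_simps)
qed (use assms in simp)

lemma summable_weighted_seminorms:
  assumes "\<And>k. 0 \<le> S k"
  shows "summable (\<lambda>k. (1 / 2) ^ Suc k * bounded_seminorm (S k))"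
proof (rule summable_comparison_test')
  show "summable (\<lambda>k. (1 / 2 :: real) ^ Suc k)" using power_half_series by (rule sums_summable)
  show "norm ((1 / 2) ^ Suc k * bounded_seminorm (S k)) \<le> (1 / 2) ^ Suc k" if "k \<ge> 0" for k
    using bounded_seminorm_nonneg[OF assms[of k]] bounded_seminorm_le_1[OF assms[of k]]
    by (simp add: abs_mult)
qed

lemma weighted_seminorm_le_suminf:
  assumes "\<And>k. 0 \<le> S k"
  shows "(1 / 2) ^ Suc k * bounded_seminorm (S k) \<le>
    (\<Sum>k. (1 / 2) ^ Suc k * bounded_seminorm (S k))"
  using sum_le_suminf[OF summable_weighted_seminorms[OF assms], of "{k}"]
  by (simp add: bounded_seminorm_nonneg assms)

text \<open>The weights of the first \<open>n\<close> terms add up to at most 1, and the remaining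
  weights to \<open>(1 / 2) ^ n\<close>. The tail bound holds whatever the later seminorms are,
  infinite ones included.\<close>

lemma suminf_weighted_seminorms_le:
  assumes "\<And>k. 0 \<le> S k" "0 \<le> \<delta>" "\<And>k. k < n \<Longrightarrow> S k \<le> ereal \<delta>"
  shows "(\<Sum>k. (1 / 2) ^ Suc k * bounded_seminorm (S k)) \<le> \<delta> + (1 / 2) ^ n"
proof -
  let ?a = "\<lambda>k. (1 / 2) ^ Suc k * bounded_seminorm (S k)"
  have summ: "summable ?a" by (rule summable_weighted_seminorms[OF assms(1)])
  have geom: "(\<lambda>k. (1 / 2) ^ n * (1 / 2 :: real) ^ Suc k) sums ((1 / 2) ^ n * 1)"
    by (intro sums_mult power_half_series)
  have "(\<Sum>k. ?a (k + n)) \<le> (\<Sum>k. (1 / 2) ^ n * (1 / 2 :: real) ^ Suc k)"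
  proof (rule suminf_le)
    fix k
    have "?a (k + n) \<le> (1 / 2) ^ Suc (k + n)"
      using bounded_seminorm_le_1[OF assms(1)[of "k + n"]] by simp
    then show "?a (k + n) \<le> (1 / 2) ^ n * (1 / 2) ^ Suc k" by (simp add: power_add mult_ac)
  qed (use summable_ignore_initial_segment[OF summ] sums_summable[OF geom] in auto)
  also have "\<dots> = (1 / 2) ^ n" using sums_unique[OF geom] by simp
  finally have tail: "(\<Sum>k. ?a (k + n)) \<le> (1 / 2) ^ n" .
  have "(\<Sum>k<n. ?a k) \<le> (\<Sum>k<n. \<delta> * (1 / 2) ^ Suc k)"
  proof (rule sum_mono)
    fix k assume "k \<in> {..<n}"
    then have "bounded_seminorm (S k) \<le> \<delta>"
      using bounded_seminorm_le[OF assms(1) assms(3)] by simp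
    then show "?a k \<le> \<delta> * (1 / 2) ^ Suc k" by (simp add: mult_ac)
  qed
  also have "\<dots> = \<delta> * (\<Sum>k<n. (1 / 2) ^ Suc k)" by (simp add: sum_distrib_left)
  also have "\<dots> \<le> \<delta> * 1"
  proof (rule mult_left_mono[OF _ assms(2)])
    have "(\<Sum>k<n. (1 / 2 :: real) ^ Suc k) \<le> (\<Sum>k. (1 / 2) ^ Suc k)"
      by (rule sum_le_suminf[OF sums_summable[OF power_half_series]]) auto
    then show "(\<Sum>k<n. (1 / 2 :: real) ^ Suc k) \<le> 1"
      using sums_unique[OF power_half_series] by simp
  qed
  finally show ?thesis using tail suminf_split_initial_segment[OF summ, of n] by simp
qed

text \<open>All terms of the metric are nonnegative, so the whole sum bounds the term with index
  \<open>k\<close>; undoing the weight and the map \<open>s / (1 + s)\<close> bounds the essential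
  supremum on that interval.\<close>

lemma AE_close_if_Linf_loc_dist_less:
  assumes "f \<in> Linf_loc" "g \<in> Linf_loc" "0 < \<eta>"
    and less: "Linf_loc_dist f g < (1 / 2) ^ Suc k * (\<eta> / (1 + \<eta>))"
  shows "AE u in lebesgue. u \<in> {- real (Suc k)..real (Suc k)} \<longrightarrow> \<bar>f u - g u\<bar> \<le> \<eta>"
proof -
  define S where "S k = esssup (lebesgue_on {- real (Suc k)..real (Suc k)}) (\<lambda>t. ereal \<bar>f t - g t\<bar>)"
    for k
  have S0: "0 \<le> S k" for k
  proof -
    let ?M = "lebesgue_on {- real (Suc k)..real (Suc k)}"
    \<comment> \<open>Positive measure matters: over a null set the essential supremum of the
      constant 0 would be negative infinity.\<close>
    have "emeasure ?M (space ?M) \<noteq> 0"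
      by (simp add: emeasure_restrict_space)
    then have "esssup ?M (\<lambda>t. 0 :: ereal) = 0" by (rule esssup_const)
    moreover have "esssup ?M (\<lambda>t. 0 :: ereal) \<le> S k"
      unfolding S_def by (rule esssup_mono) auto
    ultimately show ?thesis by simp
  qed
  have "(1 / 2) ^ Suc k * bounded_seminorm (S k) \<le> Linf_loc_dist f g"
    using weighted_seminorm_le_suminf[of S k, OF S0] by (simp add: Linf_loc_dist_def S_def)
  then have "(1 / 2) ^ Suc k * bounded_seminorm (S k) < (1 / 2) ^ Suc k * (\<eta> / (1 + \<eta>))"
    using less by linarith
  then have "bounded_seminorm (S k) < \<eta> / (1 + \<eta>)"
    by (simp add: mult_less_cancel_left_pos del: times_divide_eq_right)
  then have "S k < ereal \<eta>" by (rule less_if_bounded_seminorm_less[OF S0 assms(3)])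
  have "AE u in lebesgue_on {- real (Suc k)..real (Suc k)}. ereal \<bar>f u - g u\<bar> \<le> S k"
    unfolding S_def by (rule esssup_AE)
  then have "AE u in lebesgue_on {- real (Suc k)..real (Suc k)}. \<bar>f u - g u\<bar> \<le> \<eta>"
  proof eventually_elim
    case (elim u)
    then have "ereal \<bar>f u - g u\<bar> \<le> ereal \<eta>" using \<open>S k < ereal \<eta>\<close> by (meson order_le_less_trans less_imp_le)
    then show ?case by simp
  qed
  then show ?thesis by (simp add: AE_restrict_space_iff)
qed

lemma C0_dist_le:
  assumes "0 \<le> \<delta>" "\<And>t. \<bar>t\<bar> \<le> real n \<Longrightarrow> \<bar>\<phi> t - \<psi> t\<bar> \<le> ereal \<delta>"
  shows "C0_dist \<phi> \<psi> \<le> \<delta> + (1 / 2) ^ n"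
  unfolding C0_dist_def
proof (rule suminf_weighted_seminorms_le[OF _ assms(1)])
  show "0 \<le> (SUP t\<in>{- real (Suc k)..real (Suc k)}. \<bar>\<phi> t - \<psi> t\<bar>)" for k
    by (rule SUP_upper2[of 0]) auto
  \<comment> \<open>The index is shifted by one: for \<open>k < n\<close> the interval ends at
    \<open>Suc k \<le> n\<close>, hence lies within the controlled range.\<close>
  show "(SUP t\<in>{- real (Suc k)..real (Suc k)}. \<bar>\<phi> t - \<psi> t\<bar>) \<le> ereal \<delta>" if "k < n" for k
    by (rule SUP_least, rule assms(2)) (use that in auto)
qed

section \<open>Continuous dependence of the firing map on the input\<close>

theorem proposition2p8:
  fixes \<sigma> :: real and f :: "real \<Rightarrow> real"
  assumes "\<sigma> \<ge> 0"
    and "f \<in> Linf_loc"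
    and "\<exists>\<epsilon>>0. AE t in lebesgue. f t - \<sigma> > \<epsilon>"
  shows "firing_map \<sigma> f \<in> C0 \<and>
    (\<forall>e>0. \<exists>d>0. \<forall>g\<in>Linf_loc. Linf_loc_dist f g < d \<longrightarrow>
       C0_dist (firing_map \<sigma> f) (firing_map \<sigma> g) < e)"
proof (intro conjI allI impI)
  obtain \<epsilon> where \<epsilon>: "\<epsilon> > 0" "AE t in lebesgue. f t - \<sigma> > \<epsilon>" using assms(3) by auto
  have "AE u in lebesgue. \<epsilon> \<le> f u - \<sigma>" using \<epsilon>(2) by eventually_elim simp
  then show "firing_map \<sigma> f \<in> C0" by (rule firing_map_in_C0[OF assms(1,2) \<epsilon>(1)])
  fix e :: real assume e: "e > 0"
  \<comment> \<open>Half of the margin of \<open>f\<close> is given up, so that inputs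
    \<open>g\<close> close to \<open>f\<close> keep the rate \<open>m\<close>.\<close>
  define m where "m = \<epsilon> / 2"
  have m: "m > 0" using \<epsilon> by (simp add: m_def)
  \<comment> \<open>Beyond \<open>n\<close> the tail of the target metric costs less than
    \<open>e / 2\<close>.\<close>
  obtain n where n: "(1 / 2 :: real) ^ n < e / 2"
    using e real_arch_pow_inv[of "e / 2" "1 / 2"] by auto
  \<comment> \<open>A neuron started in \<open>[-n, n]\<close> fires within time
    \<open>1 / m\<close>, so the inputs must be close on a longer interval than the firing
    maps.\<close>
  obtain N where N: "real n + 1 / m \<le> real N" by (meson real_arch_simple)
  define C where "C = exp (\<sigma> / m) / m\<^sup>2"
  have C: "C > 0" using m by (simp add: C_def)
  \<comment> \<open>The first bound preserves the rate \<open>m\<close> for \<open>g\<close>; the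
    second makes the displacement \<open>\<eta> * C\<close> of the firing times at most
    \<open>e / 2\<close>.\<close>
  define \<eta> where "\<eta> = min m (e / (2 * C))"
  have \<eta>: "0 < \<eta>" "\<eta> \<le> m" "\<eta> * C \<le> e / 2"
    using m C e by (auto simp: \<eta>_def min_def field_simps)
  show "\<exists>d>0. \<forall>g\<in>Linf_loc. Linf_loc_dist f g < d \<longrightarrow>
       C0_dist (firing_map \<sigma> f) (firing_map \<sigma> g) < e"
  proof (intro exI[of _ "(1 / 2) ^ Suc N * (\<eta> / (1 + \<eta>))"] conjI ballI impI)
    show "0 < (1 / 2) ^ Suc N * (\<eta> / (1 + \<eta>))" using \<eta> by simp
    fix g assume g: "g \<in> Linf_loc" and "Linf_loc_dist f g < (1 / 2) ^ Suc N * (\<eta> / (1 + \<eta>))"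
    then have close: "AE u in lebesgue. u \<in> {- real (Suc N)..real (Suc N)} \<longrightarrow> \<bar>f u - g u\<bar> \<le> \<eta>"
      using AE_close_if_Linf_loc_dist_less[OF assms(2) _ \<eta>(1)] by blast
    have "\<bar>firing_map \<sigma> f t - firing_map \<sigma> g t\<bar> \<le> ereal (\<eta> * C)" if t: "\<bar>t\<bar> \<le> real n" for t
    proof -
      have "0 < 1 / m" using m by simp
      then have sub: "u \<in> {- real (Suc N)..real (Suc N)}" if "u \<in> {t..t + 1 / m}" for u
        using that t N by auto
      have fg: "AE u in lebesgue. u \<in> {t..t + 1 / m} \<longrightarrow> \<bar>f u - g u\<bar> \<le> \<eta>"
        using close by eventually_elim (use sub in blast)
      moreover have "AE u in lebesgue. u \<in> {t..t + 1 / m} \<longrightarrow> m \<le> f u - \<sigma>"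
        using \<epsilon>(2) by eventually_elim (use \<epsilon>(1) in \<open>auto simp: m_def\<close>)
      moreover have "AE u in lebesgue. u \<in> {t..t + 1 / m} \<longrightarrow> m \<le> g u - \<sigma>"
        using fg \<epsilon>(2)
      proof eventually_elim
        case (elim u)
        show ?case
        proof
          assume "u \<in> {t..t + 1 / m}"
          with elim have "\<bar>f u - g u\<bar> \<le> \<eta>" by blast
          \<comment> \<open>The input \<open>f\<close> exceeds \<open>\<sigma>\<close> by more than
            \<open>2 * m\<close>, and passing to \<open>g\<close> loses at most
            \<open>\<eta> \<le> m\<close>.\<close>
          with elim(2) \<eta>(2) show "m \<le> g u - \<sigma>" unfolding m_def by linarith
        qed
      qed
      ultimately show ?thesis
        using firing_map_perturbation[OF assms(1,2) g m, of \<eta> t] \<eta>(1) by (simp add: C_def)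
    qed
    then have "C0_dist (firing_map \<sigma> f) (firing_map \<sigma> g) \<le> \<eta> * C + (1 / 2) ^ n"
      using \<eta>(1) C by (intro C0_dist_le) auto
    then show "C0_dist (firing_map \<sigma> f) (firing_map \<sigma> g) < e" using \<eta>(3) n by linarith
  qed
qed

end
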